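(* (i) There are infinitely many optimal cubic polynomials for each of the prime numbers $2$ and $3$. Explicitly: for $p_0=2$, every polynomial $$C_1(x)=x^3+mx^2+(p_1-3-m)x+2,\qquad C_1(1)=p_1,$$ with $m$ an arbitrary integer and $p_1$ a prime number is optimal; if $|4+2m-p_1|$ is prime, then $C_1$ is bi-optimal. For $p_0=3$, every polynomial $$C_2(x)=x^3+\left[\tfrac12(p_2-3)-p_1\right]x^2+\left[2p_1-\tfrac12(p_2+5)\right]x+3,\qquad C_2(1)=p_1,\ C_2(2)=p_2,$$ with $p_1,p_2$ prime and $p_2$ odd is optimal; if $|p_2-3p_1+3|$ and $|3p_2-8p_1-6|$ are prime, then $C_2$ is bi-optimal. (ii) The following cubic polynomials are optimal: for $p_0=5$, $$C_3(x)=x^3-x^2+2x+5,\qquad C_4(x)=2x^3+4x^2-4x+5;$$ for $p_0=7$, $$C_5(x)=x^3-x^2+6x+7;$$ for $p_0=11$, $$C_6(x)=x^3+5x^2+2x+11,\qquad C_7(x)=x^3-4x^2+5x+11;$$ for $p_0=13$, $$C_8(x)=x^3-5x^2+8x+13.$$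
   Context: Let $P(x)=\sum_{j=0}^n a_jx^j$ be a non-constant polynomial with integer coefficients such that $|a_0|=p_0$ is a prime number. $P$ is called optimal (for $p_0$) if $|P(j)|$ is prime for $j=0,1,\ldots,p_0-1$. $P$ is called bi-optimal if $|P(j)|$ is prime for all integers $j$ with $1-p_0\le j\le p_0-1$. The prime values may repeat, and values of $P$ may be negative. *)

theory Defs
  imports "HOL-Computational_Algebra.Computational_Algebra"
begin

definition optimal :: "int \<Rightarrow> int poly \<Rightarrow> bool" where
  "optimal p0 P \<longleftrightarrow> prime p0 \<and> degree P > 0 \<and> \<bar>coeff P 0\<bar> = p0 \<and>
     (\<forall>j. 0 \<le> j \<and> j \<le> p0 - 1 \<longrightarrow> prime \<bar>poly P j\<bar>)"

definition bi_optimal :: "int \<Rightarrow> int poly \<Rightarrow> bool" where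
  "bi_optimal p0 P \<longleftrightarrow> prime p0 \<and> degree P > 0 \<and> \<bar>coeff P 0\<bar> = p0 \<and>
     (\<forall>j. 1 - p0 \<le> j \<and> j \<le> p0 - 1 \<longrightarrow> prime \<bar>poly P j\<bar>)"

definition C1 :: "int \<Rightarrow> int \<Rightarrow> int poly" where
  "C1 m p1 = [:2, p1 - 3 - m, m, 1:]"

text \<open>The divisions by 2 are exact whenever \<open>p2\<close> is odd, the only case of interest.\<close>

definition C2 :: "int \<Rightarrow> int \<Rightarrow> int poly" where
  "C2 p1 p2 = [:3, 2 * p1 - (p2 + 5) div 2, (p2 - 3) div 2 - p1, 1:]"

definition C3 :: "int poly" where "C3 = [:5, 2, -1, 1:]"
definition C4 :: "int poly" where "C4 = [:5, -4, 4, 2:]"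
definition C5 :: "int poly" where "C5 = [:7, 6, -1, 1:]"
definition C6 :: "int poly" where "C6 = [:11, 2, 5, 1:]"
definition C7 :: "int poly" where "C7 = [:11, 5, -4, 1:]"
definition C8 :: "int poly" where "C8 = [:13, 8, -5, 1:]"

end

theory Submission
  imports Defs
begin

text \<open>\<open>C1\<close> and \<open>C2\<close> are interpolating cubics: their coefficients are
  chosen so that the values at 0, 1 (and 2) are the prescribed primes, which gives optimality at
  once. The values at -1 (and -2) are linear in the parameters and are exactly the quantities
  assumed prime for bi-optimality (\<open>poly_C1\<close>, \<open>poly_C2\<close>). Infinitude
  follows by fixing one prime and letting the other parameter run injectively. \<open>C3\<close> to
  \<open>C8\<close> are a finite check by trial division.\<close>

text \<open>In a factorization of \<open>n\<close> one factor is below \<open>b\<close>, since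
  \<open>n < b * b\<close>. Ranging over an explicit list lets the simplifier evaluate the
  hypothesis; the alternative \<open>d = n\<close> lets a single \<open>b\<close> also serve primes
  smaller than \<open>b\<close>.\<close>

lemma prime_int_by_trial_division:
  fixes n b :: int
  assumes "1 < n" "0 \<le> b" "n < b * b" and *: "\<forall>d\<in>set [2..b - 1]. d dvd n \<longrightarrow> d = n"
  shows "prime n"
proof -
  have small: "d = 1 \<or> d = n" if "d \<ge> 0" "d dvd n" "d < b" for d
  proof -
    from that \<open>1 < n\<close> have "d \<noteq> 0" by auto
    with that * show ?thesis by (cases "d = 1") auto
  qed
  have "d = 1 \<or> d = n" if d: "d \<ge> 0" "d dvd n" for d
  proof (cases "d < b")
    case True
    with d show ?thesis using small by blast
  next
    case False
    from \<open>d dvd n\<close> obtain e where e: "n = d * e" by (elim dvdE)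
    with \<open>1 < n\<close> \<open>d \<ge> 0\<close> have "e > 0"
      by (metis linorder_not_le mult_nonneg_nonpos order_less_trans zero_less_one)
    have "e < b"
    proof (rule ccontr)
      assume "\<not> e < b"
      with False \<open>0 \<le> b\<close> \<open>d \<ge> 0\<close> have "b * b \<le> d * e"
        by (intro mult_mono) auto
      then show False using e \<open>n < b * b\<close> by simp
    qed
    \<comment> \<open>The cofactor \<open>e\<close> is 1 or \<open>n\<close>, so \<open>d\<close> is
      \<open>n\<close> or 1.\<close>
    with small[of e] e \<open>e > 0\<close> \<open>1 < n\<close> show ?thesis by auto
  qed
  with \<open>1 < n\<close> show ?thesis by (auto simp: prime_int_iff)
qed

lemma degree_C1: "degree (C1 m p1) = 3"
  by (simp add: C1_def)

lemma poly_C1: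
  "poly (C1 m p1) (-1) = 4 + 2 * m - p1" "poly (C1 m p1) 0 = 2" "poly (C1 m p1) 1 = p1"
  by (simp_all add: C1_def)

lemma optimal_C1:
  assumes "prime p1"
  shows "optimal 2 (C1 m p1)"
proof -
  have "prime \<bar>poly (C1 m p1) j\<bar>" if "0 \<le> j" "j \<le> 1" for j
  proof -
    from that have "j \<in> {0, 1}" by auto
    with assms show ?thesis by (auto simp: poly_C1)
  qed
  then show ?thesis
    \<comment> \<open>The facts on degree and values speak of the folded \<open>C1\<close>, so it is
      unfolded only afterwards, for the constant coefficient.\<close>
    by (simp add: optimal_def degree_C1) (simp add: C1_def)
qed

lemma bi_optimal_C1:
  assumes "prime p1" "prime \<bar>4 + 2 * m - p1\<bar>"
  shows "bi_optimal 2 (C1 m p1)"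
proof -
  have "prime \<bar>poly (C1 m p1) j\<bar>" if "-1 \<le> j" "j \<le> 1" for j
  proof -
    from that have "j \<in> {-1, 0, 1}" by auto
    with assms show ?thesis by (auto simp: poly_C1)
  qed
  then show ?thesis
    by (simp add: bi_optimal_def degree_C1) (simp add: C1_def)
qed

lemma degree_C2: "degree (C2 p1 p2) = 3"
  by (simp add: C2_def)

lemma poly_C2:
  assumes "odd p2"
  shows "poly (C2 p1 p2) (-2) = 3 * p2 - 8 * p1 - 6" "poly (C2 p1 p2) (-1) = p2 - 3 * p1 + 3"
    "poly (C2 p1 p2) 0 = 3" "poly (C2 p1 p2) 1 = p1" "poly (C2 p1 p2) 2 = p2"
proof -
  \<comment> \<open>Writing \<open>p2\<close> as \<open>2 * k + 1\<close> removes both divisions,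
    leaving linear identities in \<open>p1\<close> and \<open>k\<close>.\<close>
  from assms obtain k where k: "p2 = 2 * k + 1" by (elim oddE)
  then have "(p2 + 5) div 2 = k + 3" "(p2 - 3) div 2 = k - 1" by simp_all
  then have "C2 p1 p2 = [:3, 2 * p1 - (k + 3), k - 1 - p1, 1:]" by (simp add: C2_def)
  then show "poly (C2 p1 p2) (-2) = 3 * p2 - 8 * p1 - 6" "poly (C2 p1 p2) (-1) = p2 - 3 * p1 + 3"
    "poly (C2 p1 p2) 0 = 3" "poly (C2 p1 p2) 1 = p1" "poly (C2 p1 p2) 2 = p2"
    by (simp_all add: k)
qed

lemma optimal_C2:
  assumes "prime p1" "prime p2" "odd p2"
  shows "optimal 3 (C2 p1 p2)"
proof -
  have "prime \<bar>poly (C2 p1 p2) j\<bar>" if "0 \<le> j" "j \<le> 2" for j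
  proof -
    from that have "j \<in> {0, 1, 2}" by auto
    with assms show ?thesis by (auto simp: poly_C2)
  qed
  then show ?thesis
    by (simp add: optimal_def degree_C2) (simp add: C2_def)
qed

lemma bi_optimal_C2:
  assumes "prime p1" "prime p2" "odd p2"
    and "prime \<bar>p2 - 3 * p1 + 3\<bar>" "prime \<bar>3 * p2 - 8 * p1 - 6\<bar>"
  shows "bi_optimal 3 (C2 p1 p2)"
proof -
  have "prime \<bar>poly (C2 p1 p2) j\<bar>" if "-2 \<le> j" "j \<le> 2" for j
  proof -
    from that have "j \<in> {-2, -1, 0, 1, 2}" by auto
    with assms show ?thesis by (auto simp: poly_C2)
  qed
  then show ?thesis
    by (simp add: bi_optimal_def degree_C2) (simp add: C2_def)
qed

lemma infinite_optimal_2: "infinite {P. degree P = 3 \<and> optimal 2 P}"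
proof -
  \<comment> \<open>With \<open>p1 = 2\<close> fixed, \<open>m\<close> can be read off as the
    quadratic coefficient.\<close>
  have "inj (\<lambda>m. C1 m 2)"
    by (auto simp: inj_def C1_def)
  then have "infinite (range (\<lambda>m. C1 m 2))"
    by (simp add: finite_image_iff infinite_UNIV_int)
  then show ?thesis
    by (rule infinite_super[rotated]) (auto simp: degree_C1 optimal_C1)
qed

lemma infinite_optimal_3: "infinite {P. degree P = 3 \<and> optimal 3 P}"
proof -
  \<comment> \<open>With \<open>p2 = 3\<close> the quadratic coefficient is \<open>- p1\<close>. The
    primes are taken in \<open>nat\<close> to match \<open>primes_infinite\<close>.\<close>
  have "inj_on (\<lambda>p. C2 (int p) 3) {p. prime p}"
    by (auto simp: inj_on_def C2_def)
  then have "infinite ((\<lambda>p. C2 (int p) 3) ` {p. prime p})"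
    by (simp add: finite_image_iff primes_infinite)
  then show ?thesis
    by (rule infinite_super[rotated]) (auto simp: degree_C2 intro!: optimal_C2)
qed

text \<open>A quantifier over an explicit list unfolds under simplification into finitely many
  primality checks.\<close>

lemma optimal_iff_upto:
  "optimal p0 P \<longleftrightarrow> prime p0 \<and> degree P > 0 \<and> \<bar>coeff P 0\<bar> = p0 \<and>
     (\<forall>j\<in>set [0..p0 - 1]. prime \<bar>poly P j\<bar>)"
  by (auto simp: optimal_def)

text \<open>The values of \<open>C3\<close>, ..., \<open>C8\<close> in question are all below \<open>40 * 40\<close>. The deleted simp rules would
  try all divisors up to half the number.\<close>

lemma optimal_C3: "optimal 5 C3"
  by (simp add: optimal_iff_upto C3_def upto_rec1 prime_int_by_trial_division[of _ 40]
      del: prime_int_numeral_eq prime_nat_numeral_eq)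

lemma optimal_C4: "optimal 5 C4"
  by (simp add: optimal_iff_upto C4_def upto_rec1 prime_int_by_trial_division[of _ 40]
      del: prime_int_numeral_eq prime_nat_numeral_eq)

lemma optimal_C5: "optimal 7 C5"
  by (simp add: optimal_iff_upto C5_def upto_rec1 prime_int_by_trial_division[of _ 40]
      del: prime_int_numeral_eq prime_nat_numeral_eq)

lemma optimal_C6: "optimal 11 C6"
  by (simp add: optimal_iff_upto C6_def upto_rec1 prime_int_by_trial_division[of _ 40]
      del: prime_int_numeral_eq prime_nat_numeral_eq)

lemma optimal_C7: "optimal 11 C7"
  by (simp add: optimal_iff_upto C7_def upto_rec1 prime_int_by_trial_division[of _ 40]
      del: prime_int_numeral_eq prime_nat_numeral_eq)

lemma optimal_C8: "optimal 13 C8"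
  by (simp add: optimal_iff_upto C8_def upto_rec1 prime_int_by_trial_division[of _ 40]
      del: prime_int_numeral_eq prime_nat_numeral_eq)

theorem theorem4p6:
  shows "infinite {P :: int poly. degree P = 3 \<and> optimal 2 P}
    \<and> infinite {P :: int poly. degree P = 3 \<and> optimal 3 P}
    \<and> (\<forall>m p1 :: int. prime p1 \<longrightarrow>
          degree (C1 m p1) = 3 \<and> poly (C1 m p1) 1 = p1 \<and> optimal 2 (C1 m p1)
        \<and> (prime \<bar>4 + 2 * m - p1\<bar> \<longrightarrow> bi_optimal 2 (C1 m p1)))
    \<and> (\<forall>p1 p2 :: int. prime p1 \<and> prime p2 \<and> odd p2 \<longrightarrow>
          degree (C2 p1 p2) = 3 \<and> poly (C2 p1 p2) 1 = p1 \<and> poly (C2 p1 p2) 2 = p2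
        \<and> optimal 3 (C2 p1 p2)
        \<and> (prime \<bar>p2 - 3 * p1 + 3\<bar> \<and> prime \<bar>3 * p2 - 8 * p1 - 6\<bar> \<longrightarrow>
             bi_optimal 3 (C2 p1 p2)))
    \<and> (\<forall>P \<in> {C3, C4, C5, C6, C7, C8}. degree P = 3)
    \<and> optimal 5 C3 \<and> optimal 5 C4
    \<and> optimal 7 C5
    \<and> optimal 11 C6 \<and> optimal 11 C7
    \<and> optimal 13 C8"
  by (simp add: infinite_optimal_2 infinite_optimal_3 degree_C1 poly_C1 optimal_C1 bi_optimal_C1
      degree_C2 poly_C2 optimal_C2 bi_optimal_C2
      optimal_C3 optimal_C4 optimal_C5 optimal_C6 optimal_C7 optimal_C8)
    (simp add: C3_def C4_def C5_def C6_def C7_def C8_def)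

end
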